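(* Let $\mathsf{C}$ be a category and $\Phi$ a Riguet congruence on $\mathsf{C}$. Then $\Phi^{\natural\mathrm{fl}}=\Phi^{\mathrm{fl}}_{\omega}$, where $\Phi^{\natural\mathrm{fl}}$ is the morphism part of the generalized congruence $\Phi^\natural$ on $\mathsf{C}$ generated by $(\Phi^{\mathrm{ob}},\bigcup\Phi^{\mathrm{fl}})$ and $\Phi^{\mathrm{fl}}_{\omega}=\bigcup_{r\in\mathbb{N}}\Phi^{\mathrm{fl}}_{r}$.
   Context: A Riguet congruence on a category $\mathsf{C}$ is a pair $\Phi=(\Phi^{\mathrm{ob}},\Phi^{\mathrm{fl}})$ where $\Phi^{\mathrm{ob}}$ is an equivalence relation on $\mathrm{Ob}(\mathsf{C})$ and $\Phi^{\mathrm{fl}}$ assigns to all $(a,a'),(b,b')\in\Phi^{\mathrm{ob}}$ a subset $\Phi^{\mathrm{fl}}_{\left(\begin{smallmatrix}a&b\\ a'&b'\end{smallmatrix}\right)}\subseteq\mathrm{Hom}_{\mathsf{C}}(a,b)\times\mathrm{Hom}_{\mathsf{C}}(a',b')$ such that: (Ra) if $(a,b)\in\Phi^{\mathrm{ob}}$, then $(\mathrm{id}_a,\mathrm{id}_b)\in\Phi^{\mathrm{fl}}_{\left(\begin{smallmatrix}a&a\\ b&b\end{smallmatrix}\right)}$; (Rb) if $f\in\mathrm{Hom}_{\mathsf{C}}(a,b)$, then $(f,f)\in\Phi^{\mathrm{fl}}_{\left(\begin{smallmatrix}a&b\\ a&b\end{smallmatrix}\right)}$; (Rc) if $(f,f')\in\Phi^{\mathrm{fl}}_{\left(\begin{smallmatrix}a&b\\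 a'&b'\end{smallmatrix}\right)}$, then $(f',f)\in\Phi^{\mathrm{fl}}_{\left(\begin{smallmatrix}a'&b'\\ a&b\end{smallmatrix}\right)}$; (Rd) if $(f,f')\in\Phi^{\mathrm{fl}}_{\left(\begin{smallmatrix}a&b\\ a'&b'\end{smallmatrix}\right)}$ and $(f',f'')\in\Phi^{\mathrm{fl}}_{\left(\begin{smallmatrix}a'&b'\\ a''&b''\end{smallmatrix}\right)}$, then $(f,f'')\in\Phi^{\mathrm{fl}}_{\left(\begin{smallmatrix}a&b\\ a''&b''\end{smallmatrix}\right)}$; (Re) if $(f,f')\in\Phi^{\mathrm{fl}}_{\left(\begin{smallmatrix}a&b\\ a'&b'\end{smallmatrix}\right)}$ and $(g,g')\in\Phi^{\mathrm{fl}}_{\left(\begin{smallmatrix}b&c\\ b'&c'\end{smallmatrix}\right)}$, then $(g\circ f,g'\circ f')\in\Phi^{\mathrm{fl}}_{\left(\begin{smallmatrix}a&c\\ a'&c'\end{smallmatrix}\right)}$; (Rf) for all $(a,a'),(b,b')\in\Phi^{\mathrm{ob}}$ and $f\in\mathrm{Hom}_{\mathsf{C}}(a,b)$ there is $f'\in\mathrm{Hom}_{\mathsf{C}}(a',b')$ with $(f,f')\in\Phi^{\mathrm{fl}}_{\left(\begin{smallmatrix}a&b\\ a'&b'\end{smallmatrix}\right)}$. Let $\mathrm{sc}(f)$, $\mathrm{tg}(f)$ be the source and target of a morphism $f$, let $\mathrm{Mor}(\mathsf{C})^{+}$ be the set of finite nonempty sequences $(f_i)_{i\in m}=(f_0,\dots,f_{m-1})$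 of morphisms of $\mathsf{C}$, let $(f)$ be the length-one sequence, and let $\curlywedge$ be concatenation. For an equivalence relation $E$ on $\mathrm{Ob}(\mathsf{C})$, $\mathrm{Mor}(\mathsf{C})^{+}_{E}$ is the set of $E$-composable sequences: those $(f_i)_{i\in m}$ with $(\mathrm{tg}(f_i),\mathrm{sc}(f_{i+1}))\in E$ for every $i\in m-1$. A generalized congruence on $\mathsf{C}$ is a pair $\Psi=(\Psi^{\mathrm{ob}},\Psi^{\mathrm{fl}})$ where $\Psi^{\mathrm{ob}}$ is an equivalence relation on $\mathrm{Ob}(\mathsf{C})$ and $\Psi^{\mathrm{fl}}$ is an equivalence relation on $\mathrm{Mor}(\mathsf{C})^{+}_{\Psi^{\mathrm{ob}}}$ such that: (a) if $(a,b)\in\Psi^{\mathrm{ob}}$, then $((\mathrm{id}_a),(\mathrm{id}_b))\in\Psi^{\mathrm{fl}}$; (b) if $((f_i)_{i\in m},(g_j)_{j\in n})\in\Psi^{\mathrm{fl}}$, then $(\mathrm{sc}(f_0),\mathrm{sc}(g_0))\in\Psi^{\mathrm{ob}}$ and $(\mathrm{tg}(f_{m-1}),\mathrm{tg}(g_{n-1}))\in\Psi^{\mathrm{ob}}$; (c) if $\mathrm{sc}(g)=\mathrm{tg}(f)$, then $((f,g),(g\circ f))\in\Psi^{\mathrm{fl}}$; (d) if $((f_i)_{i\in m},(f'_{i'})_{i'\in m'}),((g_j)_{j\in n},(g'_{j'})_{j'\in n'})\in\Psi^{\mathrm{fl}}$ and $(\mathrm{tg}(f_{m-1}),\mathrm{sc}(g_0))\in\Psi^{\mathrm{ob}}$,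 then $((f_i)_{i\in m}\curlywedge(g_j)_{j\in n},(f'_{i'})_{i'\in m'}\curlywedge(g'_{j'})_{j'\in n'})\in\Psi^{\mathrm{fl}}$. Here $\bigcup\Phi^{\mathrm{fl}}$ is identified with the set of all pairs $((f),(f'))$ with $(f,f')$ in some component of $\Phi^{\mathrm{fl}}$, and $\Phi^{\natural}=(\Phi^{\natural\mathrm{ob}},\Phi^{\natural\mathrm{fl}})$ is the smallest (coordinatewise) generalized congruence on $\mathsf{C}$ containing $(\Phi^{\mathrm{ob}},\bigcup\Phi^{\mathrm{fl}})$; one has $\Phi^{\natural\mathrm{ob}}=\Phi^{\mathrm{ob}}$. For $\Upsilon\subseteq(\mathrm{Mor}(\mathsf{C})^{+}_{\Phi^{\mathrm{ob}}})^{2}$ put $$\mathrm{G}_{\Phi}(\Upsilon)=(\Upsilon\circ\Upsilon)\cup\left(\{(u\curlywedge v,u'\curlywedge v')\mid(u,u'),(v,v')\in\Upsilon\}\cap(\mathrm{Mor}(\mathsf{C})^{+}_{\Phi^{\mathrm{ob}}})^{2}\right).$$ Let $\mathrm{C}=\{((f,g),(g\circ f))\mid \mathrm{sc}(g)=\mathrm{tg}(f)\}$, $\Phi^{\mathrm{fl}}_{0}=\left(\bigcup\Phi^{\mathrm{fl}}\right)\cup\mathrm{C}\cup\mathrm{C}^{-1}\cup\Delta_{\mathrm{Mor}(\mathsf{C})^{+}_{\Phi^{\mathrm{ob}}}}$ and $\Phi^{\mathrm{fl}}_{r+1}=\mathrm{G}_{\Phi}(\Phi^{\mathrm{fl}}_{r})$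 for $r\geq0$. *)

theory Defs
  imports Main "HOL-Library.Product_Order"
begin

section \<open>Categories\<close>

text \<open>In \<^term>\<open>cmp C g f\<close> the morphism \<^term>\<open>f\<close> is applied first, as in $g \circ f$.  The fields
  are unconstrained outside the carriers \<^term>\<open>Ob C\<close> and \<^term>\<open>Mor C\<close>.\<close>

record ('o, 'm) cat =
  Ob :: "'o set"
  Mor :: "'m set"
  sc :: "'m \<Rightarrow> 'o"
  tg :: "'m \<Rightarrow> 'o"
  idt :: "'o \<Rightarrow> 'm"
  cmp :: "'m \<Rightarrow> 'm \<Rightarrow> 'm"

definition Hom :: "('o, 'm) cat \<Rightarrow> 'o \<Rightarrow> 'o \<Rightarrow> 'm set" where
  "Hom C a b = {f \<in> Mor C. sc C f = a \<and> tg C f = b}"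

locale category =
  fixes C :: "('o, 'm) cat"
  assumes sc_in_Ob: "f \<in> Mor C \<Longrightarrow> sc C f \<in> Ob C"
    and tg_in_Ob: "f \<in> Mor C \<Longrightarrow> tg C f \<in> Ob C"
    and idt_in_Hom: "a \<in> Ob C \<Longrightarrow> idt C a \<in> Hom C a a"
    and cmp_in_Hom: "\<lbrakk>f \<in> Hom C a b; g \<in> Hom C b c\<rbrakk> \<Longrightarrow> cmp C g f \<in> Hom C a c"
    and cmp_idt_right: "f \<in> Hom C a b \<Longrightarrow> cmp C f (idt C a) = f"
    and cmp_idt_left: "f \<in> Hom C a b \<Longrightarrow> cmp C (idt C b) f = f"
    and cmp_assoc: "\<lbrakk>f \<in> Hom C a b; g \<in> Hom C b c; h \<in> Hom C c d\<rbrakk>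
      \<Longrightarrow> cmp C h (cmp C g f) = cmp C (cmp C h g) f"

section \<open>Riguet congruences\<close>

text \<open>The component $\Phi^{\mathrm{fl}}$ with columns $(a,a')$ and $(b,b')$ is
  \<^term>\<open>snd \<Phi> (a, a') (b, b')\<close>; it is meaningful only if both pairs lie in \<^term>\<open>fst \<Phi>\<close>, and
  every use below is restricted accordingly.\<close>

type_synonym ('o, 'm) riguet_pair = "'o rel \<times> ('o \<times> 'o \<Rightarrow> 'o \<times> 'o \<Rightarrow> 'm rel)"

definition riguet_congruence :: "('o, 'm) cat \<Rightarrow> ('o, 'm) riguet_pair \<Rightarrow> bool" where
  "riguet_congruence C \<Phi> \<longleftrightarrow>
    (let E = fst \<Phi>; F = snd \<Phi> in
      equiv (Ob C) E \<and>
      (\<forall>(a, a') \<in> E. \<forall>(b, b') \<in> E. F (a, a') (b, b') \<subseteq> Hom C a b \<times> Hom C a' b') \<and>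
      (\<forall>(a, b) \<in> E. (idt C a, idt C b) \<in> F (a, b) (a, b)) \<and>
      (\<forall>a \<in> Ob C. \<forall>b \<in> Ob C. \<forall>f \<in> Hom C a b. (f, f) \<in> F (a, a) (b, b)) \<and>
      (\<forall>(a, a') \<in> E. \<forall>(b, b') \<in> E. \<forall>f f'.
        (f, f') \<in> F (a, a') (b, b') \<longrightarrow> (f', f) \<in> F (a', a) (b', b)) \<and>
      (\<forall>a a' a'' b b' b'' f f' f''.
        (a, a') \<in> E \<and> (b, b') \<in> E \<and> (a', a'') \<in> E \<and> (b', b'') \<in> E \<and>
        (f, f') \<in> F (a, a') (b, b') \<and> (f', f'') \<in> F (a', a'') (b', b'')
        \<longrightarrow> (f, f'') \<in> F (a, a'') (b, b'')) \<and>
      (\<forall>(a, a') \<in> E. \<forall>(b, b') \<in> E. \<forall>(c, c') \<in> E. \<forall>f f' g g'.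
        (f, f') \<in> F (a, a') (b, b') \<and> (g, g') \<in> F (b, b') (c, c')
        \<longrightarrow> (cmp C g f, cmp C g' f') \<in> F (a, a') (c, c')) \<and>
      (\<forall>(a, a') \<in> E. \<forall>(b, b') \<in> E. \<forall>f \<in> Hom C a b. \<exists>f' \<in> Hom C a' b'.
        (f, f') \<in> F (a, a') (b, b')))"

text \<open>$\bigcup \Phi^{\mathrm{fl}}$, with morphisms identified with sequences of length one.\<close>

definition Union_fl :: "('o, 'm) riguet_pair \<Rightarrow> 'm list rel" where
  "Union_fl \<Phi> = {([f], [f']) | f f'.
     \<exists>(a, a') \<in> fst \<Phi>. \<exists>(b, b') \<in> fst \<Phi>. (f, f') \<in> snd \<Phi> (a, a') (b, b')}"

section \<open>Generalized congruences\<close>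

definition Mor_plus :: "('o, 'm) cat \<Rightarrow> 'm list set" where
  "Mor_plus C = {fs. fs \<noteq> [] \<and> set fs \<subseteq> Mor C}"

definition Mor_comp :: "('o, 'm) cat \<Rightarrow> 'o rel \<Rightarrow> 'm list set" where
  "Mor_comp C E = {fs \<in> Mor_plus C. \<forall>i < length fs - 1. (tg C (fs ! i), sc C (fs ! Suc i)) \<in> E}"

definition generalized_congruence :: "('o, 'm) cat \<Rightarrow> 'o rel \<times> 'm list rel \<Rightarrow> bool" where
  "generalized_congruence C \<Psi> \<longleftrightarrow>
    (let E = fst \<Psi>; F = snd \<Psi> in
      equiv (Ob C) E \<and> equiv (Mor_comp C E) F \<and>
      (\<forall>(a, b) \<in> E. ([idt C a], [idt C b]) \<in> F) \<and>
      (\<forall>(fs, gs) \<in> F. (sc C (hd fs), sc C (hd gs)) \<in> E \<and> (tg C (last fs), tg C (last gs)) \<in> E) \<and>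
      (\<forall>f \<in> Mor C. \<forall>g \<in> Mor C. sc C g = tg C f \<longrightarrow> ([f, g], [cmp C g f]) \<in> F) \<and>
      (\<forall>(fs, fs') \<in> F. \<forall>(gs, gs') \<in> F.
        (tg C (last fs), sc C (hd gs)) \<in> E \<longrightarrow> (fs @ gs, fs' @ gs') \<in> F))"

text \<open>The order on pairs of relations is coordinatewise inclusion.\<close>

definition generated_congruence ::
    "('o, 'm) cat \<Rightarrow> 'o rel \<times> 'm list rel \<Rightarrow> 'o rel \<times> 'm list rel" where
  "generated_congruence C X = (LEAST \<Psi>. generalized_congruence C \<Psi> \<and> X \<le> \<Psi>)"

definition natural_congruence ::
    "('o, 'm) cat \<Rightarrow> ('o, 'm) riguet_pair \<Rightarrow> 'o rel \<times> 'm list rel" where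
  "natural_congruence C \<Phi> = generated_congruence C (fst \<Phi>, Union_fl \<Phi>)"

section \<open>The stages of the generating process\<close>

definition comp_pairs :: "('o, 'm) cat \<Rightarrow> 'm list rel" where
  "comp_pairs C = {([f, g], [cmp C g f]) | f g. f \<in> Mor C \<and> g \<in> Mor C \<and> sc C g = tg C f}"

definition G_step :: "('o, 'm) cat \<Rightarrow> 'o rel \<Rightarrow> 'm list rel \<Rightarrow> 'm list rel" where
  "G_step C E U = (U O U) \<union>
     ({(u @ v, u' @ v') | u u' v v'. (u, u') \<in> U \<and> (v, v') \<in> U} \<inter> (Mor_comp C E \<times> Mor_comp C E))"

primrec Phi_fl :: "('o, 'm) cat \<Rightarrow> ('o, 'm) riguet_pair \<Rightarrow> nat \<Rightarrow> 'm list rel" where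
  "Phi_fl C \<Phi> 0 =
     Union_fl \<Phi> \<union> comp_pairs C \<union> (comp_pairs C)\<inverse> \<union> Id_on (Mor_comp C (fst \<Phi>))"
| "Phi_fl C \<Phi> (Suc r) = G_step C (fst \<Phi>) (Phi_fl C \<Phi> r)"

definition Phi_fl_omega :: "('o, 'm) cat \<Rightarrow> ('o, 'm) riguet_pair \<Rightarrow> 'm list rel" where
  "Phi_fl_omega C \<Phi> = (\<Union>r. Phi_fl C \<Phi> r)"

section \<open>Existence of the generated generalized congruence\<close>

lemma generalized_congruenceD:
  assumes "generalized_congruence C \<Psi>"
  shows "equiv (Ob C) (fst \<Psi>)"
    and "equiv (Mor_comp C (fst \<Psi>)) (snd \<Psi>)"
    and "(a, b) \<in> fst \<Psi> \<Longrightarrow> ([idt C a], [idt C b]) \<in> snd \<Psi>"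
    and "(fs, gs) \<in> snd \<Psi> \<Longrightarrow> (sc C (hd fs), sc C (hd gs)) \<in> fst \<Psi>"
    and "(fs, gs) \<in> snd \<Psi> \<Longrightarrow> (tg C (last fs), tg C (last gs)) \<in> fst \<Psi>"
    and "\<lbrakk>f \<in> Mor C; g \<in> Mor C; sc C g = tg C f\<rbrakk> \<Longrightarrow> ([f, g], [cmp C g f]) \<in> snd \<Psi>"
    and "\<lbrakk>(fs, fs') \<in> snd \<Psi>; (gs, gs') \<in> snd \<Psi>; (tg C (last fs), sc C (hd gs)) \<in> fst \<Psi>\<rbrakk>
      \<Longrightarrow> (fs @ gs, fs' @ gs') \<in> snd \<Psi>"
proof -
  note * = assms[unfolded generalized_congruence_def Let_def]
  show "equiv (Ob C) (fst \<Psi>)"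
    using * by (rule conjunct1)
  show "equiv (Mor_comp C (fst \<Psi>)) (snd \<Psi>)"
    using *[THEN conjunct2] by (rule conjunct1)
  have a: "\<forall>(a, b) \<in> fst \<Psi>. ([idt C a], [idt C b]) \<in> snd \<Psi>"
    using *[THEN conjunct2, THEN conjunct2] by (rule conjunct1)
  have b: "\<forall>(fs, gs) \<in> snd \<Psi>. (sc C (hd fs), sc C (hd gs)) \<in> fst \<Psi> \<and>
      (tg C (last fs), tg C (last gs)) \<in> fst \<Psi>"
    using *[THEN conjunct2, THEN conjunct2, THEN conjunct2] by (rule conjunct1)
  have c: "\<forall>f \<in> Mor C. \<forall>g \<in> Mor C. sc C g = tg C f \<longrightarrow> ([f, g], [cmp C g f]) \<in> snd \<Psi>"
    using *[THEN conjunct2, THEN conjunct2, THEN conjunct2, THEN conjunct2] by (rule conjunct1)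
  have d: "\<forall>(fs, fs') \<in> snd \<Psi>. \<forall>(gs, gs') \<in> snd \<Psi>.
      (tg C (last fs), sc C (hd gs)) \<in> fst \<Psi> \<longrightarrow> (fs @ gs, fs' @ gs') \<in> snd \<Psi>"
    using *[THEN conjunct2, THEN conjunct2, THEN conjunct2, THEN conjunct2] by (rule conjunct2)
  show "(a, b) \<in> fst \<Psi> \<Longrightarrow> ([idt C a], [idt C b]) \<in> snd \<Psi>"
    using a by blast
  show "(fs, gs) \<in> snd \<Psi> \<Longrightarrow> (sc C (hd fs), sc C (hd gs)) \<in> fst \<Psi>"
    "(fs, gs) \<in> snd \<Psi> \<Longrightarrow> (tg C (last fs), tg C (last gs)) \<in> fst \<Psi>"
    using b by blast+
  show "\<lbrakk>f \<in> Mor C; g \<in> Mor C; sc C g = tg C f\<rbrakk> \<Longrightarrow> ([f, g], [cmp C g f]) \<in> snd \<Psi>"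
    using c by blast
  show "\<lbrakk>(fs, fs') \<in> snd \<Psi>; (gs, gs') \<in> snd \<Psi>; (tg C (last fs), sc C (hd gs)) \<in> fst \<Psi>\<rbrakk>
      \<Longrightarrow> (fs @ gs, fs' @ gs') \<in> snd \<Psi>"
    using d by blast
qed

lemma equiv_INT:
  assumes "\<And>i. i \<in> I \<Longrightarrow> equiv (A i) (R i)"
  shows "equiv (\<Inter>i\<in>I. A i) (\<Inter>i\<in>I. R i)"
proof (rule equivI)
  have R: "R i \<subseteq> A i \<times> A i" "refl_on (A i) (R i)" "sym (R i)" "trans (R i)" if "i \<in> I" for i
    using assms[OF that] by (auto elim: equivE)
  show "(\<Inter>i\<in>I. R i) \<subseteq> (\<Inter>i\<in>I. A i) \<times> (\<Inter>i\<in>I. A i)"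
  proof
    fix p assume "p \<in> (\<Inter>i\<in>I. R i)"
    then have "p \<in> A i \<times> A i" if "i \<in> I" for i
      using R(1)[OF that] that by blast
    then show "p \<in> (\<Inter>i\<in>I. A i) \<times> (\<Inter>i\<in>I. A i)"
      by (cases p) auto
  qed
  show "refl_on (\<Inter>i\<in>I. A i) (\<Inter>i\<in>I. R i)"
    by (rule refl_onI) (auto intro: refl_onD[OF R(2)])
  show "sym (\<Inter>i\<in>I. R i)"
    by (intro sym_INTER ballI R(3))
  show "trans (\<Inter>i\<in>I. R i)"
    by (intro trans_INTER ballI R(4))
qed

lemma generalized_congruence_Inter:
  assumes ne: "S \<noteq> {}" and S: "\<And>\<Psi>. \<Psi> \<in> S \<Longrightarrow> generalized_congruence C \<Psi>"
  shows "generalized_congruence C (\<Inter>\<Psi>\<in>S. fst \<Psi>, \<Inter>\<Psi>\<in>S. snd \<Psi>)"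
proof -
  note D = generalized_congruenceD[OF S]
  have 1: "equiv (Ob C) (\<Inter>\<Psi>\<in>S. fst \<Psi>)"
    using equiv_INT[of S "\<lambda>_. Ob C" fst] D(1) ne by simp
  have M: "Mor_comp C (\<Inter>\<Psi>\<in>S. fst \<Psi>) = (\<Inter>\<Psi>\<in>S. Mor_comp C (fst \<Psi>))"
    using ne by (auto simp: Mor_comp_def)
  have 2: "equiv (Mor_comp C (\<Inter>\<Psi>\<in>S. fst \<Psi>)) (\<Inter>\<Psi>\<in>S. snd \<Psi>)"
    unfolding M by (rule equiv_INT) (rule D(2))
  let ?E = "\<Inter>\<Psi>\<in>S. fst \<Psi>" and ?F = "\<Inter>\<Psi>\<in>S. snd \<Psi>"
  have 3: "([idt C a], [idt C b]) \<in> ?F" if "(a, b) \<in> ?E" for a b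
    using that by (intro INT_I D(3)) auto
  have 4: "(sc C (hd fs), sc C (hd gs)) \<in> ?E \<and> (tg C (last fs), tg C (last gs)) \<in> ?E"
    if "(fs, gs) \<in> ?F" for fs gs
    using that by (intro conjI INT_I D(4,5)) auto
  have 5: "([f, g], [cmp C g f]) \<in> ?F" if "f \<in> Mor C" "g \<in> Mor C" "sc C g = tg C f" for f g
    using that by (intro INT_I D(6)) auto
  have 6: "(fs @ gs, fs' @ gs') \<in> ?F"
    if "(fs, fs') \<in> ?F" "(gs, gs') \<in> ?F" "(tg C (last fs), sc C (hd gs)) \<in> ?E" for fs fs' gs gs'
    using that by (intro INT_I D(7)) auto
  show ?thesis
    unfolding generalized_congruence_def Let_def fst_conv snd_conv
    by (intro conjI ballI impI case_prodI2 1 2; (rule 3 | rule 4[THEN conjunct1] | rule 4[THEN conjunct2] | rule 5 | rule 6); hypsubst?; assumption)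
qed

lemma generalized_congruence_full:
  assumes "category C"
  shows "generalized_congruence C (Ob C \<times> Ob C, Mor_plus C \<times> Mor_plus C)"
proof -
  interpret category C by fact
  have "Mor_comp C (Ob C \<times> Ob C) = Mor_plus C"
    by (force simp: Mor_comp_def Mor_plus_def sc_in_Ob tg_in_Ob subset_iff)
  moreover have "cmp C g f \<in> Mor C" if "f \<in> Mor C" "g \<in> Mor C" "sc C g = tg C f" for f g
    using cmp_in_Hom[of f "sc C f" "tg C f" g "tg C g"] that by (simp add: Hom_def)
  moreover have "idt C a \<in> Mor C" if "a \<in> Ob C" for a
    using idt_in_Hom[OF that] by (simp add: Hom_def)
  moreover have "sc C (hd fs) \<in> Ob C" "tg C (last fs) \<in> Ob C" if "fs \<in> Mor_plus C" for fs
    using that hd_in_set[of fs] last_in_set[of fs] by (auto simp: Mor_plus_def intro!: sc_in_Ob tg_in_Ob)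
  moreover have "equiv (Ob C) (Ob C \<times> Ob C)" "equiv (Mor_plus C) (Mor_plus C \<times> Mor_plus C)"
    by (auto simp: equiv_def refl_on_def sym_def trans_def)
  ultimately show ?thesis
    unfolding generalized_congruence_def Let_def fst_conv snd_conv
    by (auto simp: Mor_plus_def)
qed

lemma generated_congruence_least:
  fixes C :: "('o, 'm) cat"
  assumes "category C" and "A \<subseteq> Ob C \<times> Ob C" and "B \<subseteq> Mor_plus C \<times> Mor_plus C"
  shows "generalized_congruence C (generated_congruence C (A, B))"
    and "(A, B) \<le> generated_congruence C (A, B)"
    and "\<lbrakk>generalized_congruence C \<Psi>; (A, B) \<le> \<Psi>\<rbrakk> \<Longrightarrow> generated_congruence C (A, B) \<le> \<Psi>"
proof -
  define S where "S = {\<Psi>. generalized_congruence C \<Psi> \<and> (A, B) \<le> \<Psi>}"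
  let ?I = "(\<Inter>\<Psi>\<in>S. fst \<Psi>, \<Inter>\<Psi>\<in>S. snd \<Psi>)"
  have "S \<noteq> {}"
    using generalized_congruence_full[OF assms(1)] assms(2,3) by (auto simp: S_def less_eq_prod_def)
  then have I: "generalized_congruence C ?I \<and> (A, B) \<le> ?I"
    by (intro conjI generalized_congruence_Inter) (auto simp: S_def less_eq_prod_def)
  have least: "?I \<le> \<Psi>" if "generalized_congruence C \<Psi> \<and> (A, B) \<le> \<Psi>" for \<Psi>
    using that by (auto simp: S_def less_eq_prod_def)
  have eq: "generated_congruence C (A, B) = ?I"
    unfolding generated_congruence_def using I least by (rule Least_equality)
  show "generalized_congruence C (generated_congruence C (A, B))"
    "(A, B) \<le> generated_congruence C (A, B)"
    using I by (simp_all only: eq)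
  show "generated_congruence C (A, B) \<le> \<Psi>" if "generalized_congruence C \<Psi>" "(A, B) \<le> \<Psi>"
    using least that by (simp only: eq)
qed

end

theory Submission
  imports Defs
begin

text \<open>
  The stages only ever apply transitivity and concatenation of composable sequences to pairs that
  a generalized congruence over \<^term>\<open>fst \<Phi>\<close> containing \<^term>\<open>Union_fl \<Phi>\<close> must contain, so their
  union lies inside every such congruence (\<open>Phi_fl_omega_subset\<close>).  Conversely the union is itself
  a generalized congruence over \<^term>\<open>fst \<Phi>\<close> (\<open>generalized_congruence_Phi_fl_omega\<close>), and by
  minimality it then is the generated one.

  For the converse, reflexivity is put in at stage 0.  It makes the stages increasing, so two pairs
  of the union always lie in a common stage, and the next stage contains their composite and their
  concatenation.  Symmetry holds at stage 0, where a Riguet congruence is symmetric and the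
  composition pairs come with their converses, and it passes through each step.

  What needs an idea is that related sequences have related endpoints: without it, concatenating
  two pairs whose left components are composable might give right components that are not, and
  the intersection in the definition of a step would discard the pair.  The relation
  \<^emph>\<open>both sequences are composable and have related endpoints\<close> is itself a generalized congruence
  over \<^term>\<open>fst \<Phi>\<close> containing \<^term>\<open>Union_fl \<Phi>\<close>.  The first inclusion, applied to it, therefore
  bounds the union of the stages.
\<close>

section \<open>Composable sequences\<close>

lemma Mor_comp_Cons:
  "f # fs \<in> Mor_comp C E \<longleftrightarrow>
     f \<in> Mor C \<and> (fs = [] \<or> fs \<in> Mor_comp C E \<and> (tg C f, sc C (hd fs)) \<in> E)"
proof (cases fs)
  case Nil
  then show ?thesis by (simp add: Mor_comp_def Mor_plus_def)
next
  case (Cons g gs)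
  then show ?thesis
    by (auto simp: Mor_comp_def Mor_plus_def nth_Cons less_Suc_eq_0_disj split: nat.splits)
qed

lemma Nil_notin_Mor_comp: "[] \<notin> Mor_comp C E"
  by (simp add: Mor_comp_def Mor_plus_def)

lemma Mor_comp_append:
  assumes "u \<noteq> []" "v \<noteq> []"
  shows "u @ v \<in> Mor_comp C E \<longleftrightarrow>
    u \<in> Mor_comp C E \<and> v \<in> Mor_comp C E \<and> (tg C (last u), sc C (hd v)) \<in> E"
  using assms by (induction u) (auto simp: Mor_comp_Cons Nil_notin_Mor_comp)

lemma (in category) Mor_comp_endpoints:
  assumes "fs \<in> Mor_comp C E"
  shows "sc C (hd fs) \<in> Ob C" "tg C (last fs) \<in> Ob C"
proof -
  have "hd fs \<in> Mor C" "last fs \<in> Mor C"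
    using assms hd_in_set[of fs] last_in_set[of fs] by (auto simp: Mor_comp_def Mor_plus_def)
  then show "sc C (hd fs) \<in> Ob C" "tg C (last fs) \<in> Ob C"
    by (simp_all add: sc_in_Ob tg_in_Ob)
qed

lemma (in category) cmp_carrier:
  assumes "f \<in> Mor C" "g \<in> Mor C" "sc C g = tg C f"
  shows "cmp C g f \<in> Mor C" "sc C (cmp C g f) = sc C f" "tg C (cmp C g f) = tg C g"
  using cmp_in_Hom[of f "sc C f" "tg C f" g "tg C g"] assms by (auto simp: Hom_def)

lemma (in category) idt_carrier:
  assumes "a \<in> Ob C"
  shows "idt C a \<in> Mor C" "sc C (idt C a) = a" "tg C (idt C a) = a"
  using idt_in_Hom[OF assms] by (auto simp: Hom_def)

section \<open>The coarsest generalized congruence over an equivalence of objects\<close>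

definition endpoint_rel :: "('o, 'm) cat \<Rightarrow> 'o rel \<Rightarrow> 'm list rel" where
  "endpoint_rel C E = {(fs, gs). fs \<in> Mor_comp C E \<and> gs \<in> Mor_comp C E \<and>
     (sc C (hd fs), sc C (hd gs)) \<in> E \<and> (tg C (last fs), tg C (last gs)) \<in> E}"

text \<open>If \<open>fs\<close> meets \<open>gs\<close> and the endpoints of \<open>fs'\<close> and \<open>gs'\<close> are related to theirs, then, as
  \<open>E\<close> is an equivalence, \<open>fs'\<close> meets \<open>gs'\<close>.\<close>

lemma (in category) generalized_congruence_endpoint_rel:
  assumes E: "equiv (Ob C) E"
  shows "generalized_congruence C (E, endpoint_rel C E)"
proof -
  have E_sym: "(b, a) \<in> E" if "(a, b) \<in> E" for a b
    using E that by (meson equivE symD)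
  have E_trans: "(a, c) \<in> E" if "(a, b) \<in> E" "(b, c) \<in> E" for a b c
    using E that by (meson equivE transD)
  have E_refl: "(a, a) \<in> E" if "a \<in> Ob C" for a
    using E that by (meson equivE refl_onD)
  have E_Ob: "a \<in> Ob C" "b \<in> Ob C" if "(a, b) \<in> E" for a b
    using E that by (auto simp: equiv_def)
  have eq: "equiv (Mor_comp C E) (endpoint_rel C E)"
  proof (rule equivI)
    show "endpoint_rel C E \<subseteq> Mor_comp C E \<times> Mor_comp C E"
      by (auto simp: endpoint_rel_def)
    show "refl_on (Mor_comp C E) (endpoint_rel C E)"
      by (rule refl_onI) (simp add: endpoint_rel_def E_refl Mor_comp_endpoints)
    show "sym (endpoint_rel C E)"
      by (rule symI) (simp add: endpoint_rel_def E_sym)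
    show "trans (endpoint_rel C E)"
      by (rule transI, clarsimp simp: endpoint_rel_def) (meson E_trans)
  qed
  have app: "(fs @ gs, fs' @ gs') \<in> endpoint_rel C E"
    if fs: "(fs, fs') \<in> endpoint_rel C E" and gs: "(gs, gs') \<in> endpoint_rel C E"
      and meet: "(tg C (last fs), sc C (hd gs)) \<in> E" for fs fs' gs gs'
  proof -
    have ne: "fs \<noteq> []" "fs' \<noteq> []" "gs \<noteq> []" "gs' \<noteq> []"
      using fs gs Nil_notin_Mor_comp by (auto simp: endpoint_rel_def)
    have "(tg C (last fs'), sc C (hd gs')) \<in> E"
      using fs gs meet by (simp add: endpoint_rel_def) (meson E_trans E_sym)
    then show ?thesis
      using fs gs meet ne by (simp add: endpoint_rel_def Mor_comp_append)
  qed
  show ?thesis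
    unfolding generalized_congruence_def Let_def fst_conv snd_conv
  proof (intro conjI)
    show "\<forall>(a, b) \<in> E. ([idt C a], [idt C b]) \<in> endpoint_rel C E"
    proof (clarify)
      fix a b assume ab: "(a, b) \<in> E"
      then show "([idt C a], [idt C b]) \<in> endpoint_rel C E"
        using idt_carrier[OF E_Ob(1)[OF ab]] idt_carrier[OF E_Ob(2)[OF ab]]
        by (simp add: endpoint_rel_def Mor_comp_Cons)
    qed
    show "\<forall>f \<in> Mor C. \<forall>g \<in> Mor C. sc C g = tg C f \<longrightarrow> ([f, g], [cmp C g f]) \<in> endpoint_rel C E"
      by (auto simp: endpoint_rel_def Mor_comp_Cons cmp_carrier intro: E_refl sc_in_Ob tg_in_Ob)
    show "\<forall>(fs, gs) \<in> endpoint_rel C E.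
        (sc C (hd fs), sc C (hd gs)) \<in> E \<and> (tg C (last fs), tg C (last gs)) \<in> E"
      by (auto simp: endpoint_rel_def)
    show "\<forall>(fs, fs') \<in> endpoint_rel C E. \<forall>(gs, gs') \<in> endpoint_rel C E.
        (tg C (last fs), sc C (hd gs)) \<in> E \<longrightarrow> (fs @ gs, fs' @ gs') \<in> endpoint_rel C E"
      using app by blast
  qed (fact E eq)+
qed

section \<open>Riguet congruences\<close>

lemma riguet_congruenceD:
  assumes "riguet_congruence C \<Phi>"
  shows riguet_congruence_equiv: "equiv (Ob C) (fst \<Phi>)"
    and riguet_congruence_Hom:
      "\<lbrakk>(a, a') \<in> fst \<Phi>; (b, b') \<in> fst \<Phi>; (f, f') \<in> snd \<Phi> (a, a') (b, b')\<rbrakk>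
        \<Longrightarrow> f \<in> Hom C a b \<and> f' \<in> Hom C a' b'"
    and riguet_congruence_idt:
      "(a, b) \<in> fst \<Phi> \<Longrightarrow> (idt C a, idt C b) \<in> snd \<Phi> (a, b) (a, b)"
    and riguet_congruence_sym:
      "\<lbrakk>(a, a') \<in> fst \<Phi>; (b, b') \<in> fst \<Phi>; (f, f') \<in> snd \<Phi> (a, a') (b, b')\<rbrakk>
        \<Longrightarrow> (f', f) \<in> snd \<Phi> (a', a) (b', b)"
proof -
  note R = assms[unfolded riguet_congruence_def Let_def]
  show "equiv (Ob C) (fst \<Phi>)"
    using R by (rule conjunct1)
  note R = R[THEN conjunct2]
  show "\<lbrakk>(a, a') \<in> fst \<Phi>; (b, b') \<in> fst \<Phi>; (f, f') \<in> snd \<Phi> (a, a') (b, b')\<rbrakk>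
      \<Longrightarrow> f \<in> Hom C a b \<and> f' \<in> Hom C a' b'"
    using R[THEN conjunct1] by fast
  note R = R[THEN conjunct2]
  show "(a, b) \<in> fst \<Phi> \<Longrightarrow> (idt C a, idt C b) \<in> snd \<Phi> (a, b) (a, b)"
    using R[THEN conjunct1] by fast
  note R = R[THEN conjunct2, THEN conjunct2]
  show "\<lbrakk>(a, a') \<in> fst \<Phi>; (b, b') \<in> fst \<Phi>; (f, f') \<in> snd \<Phi> (a, a') (b, b')\<rbrakk>
      \<Longrightarrow> (f', f) \<in> snd \<Phi> (a', a) (b', b)"
    using R[THEN conjunct1] by fast
qed

lemma Union_fl_idt:
  assumes "riguet_congruence C \<Phi>" "(a, b) \<in> fst \<Phi>"
  shows "([idt C a], [idt C b]) \<in> Union_fl \<Phi>"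
  using riguet_congruence_idt[OF assms] assms(2) by (auto simp: Union_fl_def)

lemma sym_Union_fl:
  assumes "riguet_congruence C \<Phi>"
  shows "sym (Union_fl \<Phi>)"
proof (rule symI)
  fix x y assume "(x, y) \<in> Union_fl \<Phi>"
  then obtain a a' b b' f f' where xy: "x = [f]" "y = [f']"
    and E: "(a, a') \<in> fst \<Phi>" "(b, b') \<in> fst \<Phi>" and F: "(f, f') \<in> snd \<Phi> (a, a') (b, b')"
    by (auto simp: Union_fl_def)
  have "(f', f) \<in> snd \<Phi> (a', a) (b', b)"
    using riguet_congruence_sym[OF assms E F] .
  moreover have "(a', a) \<in> fst \<Phi>" "(b', b) \<in> fst \<Phi>"
    using riguet_congruence_equiv[OF assms] E by (meson equivE symD)+
  ultimately show "(y, x) \<in> Union_fl \<Phi>"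
    by (auto simp: Union_fl_def xy)
qed

lemma Union_fl_subset_endpoint_rel:
  assumes "riguet_congruence C \<Phi>"
  shows "Union_fl \<Phi> \<subseteq> endpoint_rel C (fst \<Phi>)"
proof
  fix p assume "p \<in> Union_fl \<Phi>"
  then obtain a a' b b' f f' where p: "p = ([f], [f'])"
    and E: "(a, a') \<in> fst \<Phi>" "(b, b') \<in> fst \<Phi>" and F: "(f, f') \<in> snd \<Phi> (a, a') (b, b')"
    by (auto simp: Union_fl_def)
  then show "p \<in> endpoint_rel C (fst \<Phi>)"
    using riguet_congruence_Hom[OF assms E F] by (auto simp: endpoint_rel_def Mor_comp_Cons Hom_def)
qed

section \<open>The stages lie in every congruence\<close>

lemma G_step_subset:
  assumes gc: "generalized_congruence C (E, F)" and "U \<subseteq> F"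
  shows "G_step C E U \<subseteq> F"
proof -
  note D = generalized_congruenceD[OF gc, unfolded fst_conv snd_conv]
  have "U O U \<subseteq> F"
    using \<open>U \<subseteq> F\<close> D(2) by (blast elim: equivE dest: transD)
  moreover have "(u @ v, u' @ v') \<in> F"
    if "(u, u') \<in> U" "(v, v') \<in> U" "u @ v \<in> Mor_comp C E" for u u' v v'
  proof (rule D(7))
    show uv: "(u, u') \<in> F" "(v, v') \<in> F"
      using that \<open>U \<subseteq> F\<close> by auto
    then have "u \<in> Mor_comp C E" "v \<in> Mor_comp C E"
      using D(2) by (auto simp: equiv_def)
    then show "(tg C (last u), sc C (hd v)) \<in> E"
      using that(3) Mor_comp_append[of u v C E] Nil_notin_Mor_comp[of C E] by metis
  qed
  ultimately show ?thesis
    by (auto simp: G_step_def)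
qed

lemma Phi_fl_omega_subset:
  assumes gc: "generalized_congruence C (fst \<Phi>, F)" and Un: "Union_fl \<Phi> \<subseteq> F"
  shows "Phi_fl_omega C \<Phi> \<subseteq> F"
proof -
  note D = generalized_congruenceD[OF gc, unfolded fst_conv snd_conv]
  have "Phi_fl C \<Phi> r \<subseteq> F" for r
  proof (induction r)
    case 0
    have "comp_pairs C \<subseteq> F"
      using D(6) by (auto simp: comp_pairs_def)
    moreover from this have "(comp_pairs C)\<inverse> \<subseteq> F"
      using D(2) by (blast elim: equivE dest: symD)
    moreover have "Id_on (Mor_comp C (fst \<Phi>)) \<subseteq> F"
      using D(2) by (blast elim: equivE dest: refl_onD)
    ultimately show ?case
      using Un by simp
  next
    case (Suc r)
    then show ?case
      using G_step_subset[OF gc] by simp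
  qed
  then show ?thesis
    by (auto simp: Phi_fl_omega_def)
qed

section \<open>The union of the stages is a congruence\<close>

lemma sym_G_step:
  assumes "sym U"
  shows "sym (G_step C E U)"
proof (rule symI)
  fix x y assume "(x, y) \<in> G_step C E U"
  then show "(y, x) \<in> G_step C E U"
    unfolding G_step_def using symD[OF assms] by blast
qed

lemma sym_Phi_fl:
  assumes "riguet_congruence C \<Phi>"
  shows "sym (Phi_fl C \<Phi> r)"
proof (induction r)
  case 0
  then show ?case
    using sym_Un[OF sym_Un_converse[of "comp_pairs C"] sym_Id_on[of "Mor_comp C (fst \<Phi>)"]]
      sym_Un[OF sym_Union_fl[OF assms]] by (simp add: Un_assoc)
next
  case (Suc r)
  then show ?case
    unfolding Phi_fl.simps(2) by (rule sym_G_step)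
qed

lemma Phi_fl_subset_omega: "Phi_fl C \<Phi> r \<subseteq> Phi_fl_omega C \<Phi>"
  by (auto simp: Phi_fl_omega_def)

lemma Phi_fl_omega_subset_endpoint_rel:
  assumes "category C" "riguet_congruence C \<Phi>"
  shows "Phi_fl_omega C \<Phi> \<subseteq> endpoint_rel C (fst \<Phi>)"
  using Phi_fl_omega_subset[OF category.generalized_congruence_endpoint_rel[OF assms(1)
      riguet_congruence_equiv[OF assms(2)]] Union_fl_subset_endpoint_rel[OF assms(2)]] .

text \<open>A pair is its own composite with a diagonal pair, and the diagonal, present at stage 0,
  is carried along.\<close>

lemma mono_Phi_fl:
  assumes "category C" "riguet_congruence C \<Phi>"
  shows "mono (Phi_fl C \<Phi>)"
proof -
  let ?I = "Id_on (Mor_comp C (fst \<Phi>))"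
  have step: "U \<subseteq> G_step C (fst \<Phi>) U" if "?I \<subseteq> U" "U \<subseteq> Phi_fl_omega C \<Phi>" for U
  proof
    fix p assume "p \<in> U"
    then obtain x y where p: "p = (x, y)" "(x, y) \<in> U"
      by (cases p) auto
    then have "(x, x) \<in> U"
      using that Phi_fl_omega_subset_endpoint_rel[OF assms] by (auto simp: endpoint_rel_def)
    then show "p \<in> G_step C (fst \<Phi>) U"
      using p by (auto simp: G_step_def)
  qed
  have I: "?I \<subseteq> Phi_fl C \<Phi> r" for r
  proof (induction r)
    case (Suc r)
    then show ?case
      using step[OF Suc Phi_fl_subset_omega] by simp
  qed simp
  show ?thesis
    unfolding mono_iff_le_Suc Phi_fl.simps(2) using step[OF I Phi_fl_subset_omega] by blast
qed

lemma Phi_fl_omega_common_stage: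
  assumes "category C" "riguet_congruence C \<Phi>"
    and "p \<in> Phi_fl_omega C \<Phi>" "q \<in> Phi_fl_omega C \<Phi>"
  obtains r where "p \<in> Phi_fl C \<Phi> r" "q \<in> Phi_fl C \<Phi> r"
proof -
  obtain s t where "p \<in> Phi_fl C \<Phi> s" "q \<in> Phi_fl C \<Phi> t"
    using assms(3,4) by (auto simp: Phi_fl_omega_def)
  moreover have "Phi_fl C \<Phi> s \<subseteq> Phi_fl C \<Phi> (max s t)" "Phi_fl C \<Phi> t \<subseteq> Phi_fl C \<Phi> (max s t)"
    using mono_Phi_fl[OF assms(1,2)] by (simp_all add: monoD)
  ultimately show thesis
    by (intro that[of "max s t"]) (erule subsetD[rotated], assumption)+
qed

lemma equiv_Phi_fl_omega:
  assumes "category C" "riguet_congruence C \<Phi>"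
  shows "equiv (Mor_comp C (fst \<Phi>)) (Phi_fl_omega C \<Phi>)"
proof (rule equivI)
  show "Phi_fl_omega C \<Phi> \<subseteq> Mor_comp C (fst \<Phi>) \<times> Mor_comp C (fst \<Phi>)"
    using Phi_fl_omega_subset_endpoint_rel[OF assms] by (auto simp: endpoint_rel_def)
  show "refl_on (Mor_comp C (fst \<Phi>)) (Phi_fl_omega C \<Phi>)"
    using Phi_fl_subset_omega[of C \<Phi> 0] by (intro refl_onI) auto
  show "sym (Phi_fl_omega C \<Phi>)"
    unfolding Phi_fl_omega_def using sym_Phi_fl[OF assms(2)] by (intro sym_UNION) auto
  show "trans (Phi_fl_omega C \<Phi>)"
  proof (rule transI)
    fix x y z assume "(x, y) \<in> Phi_fl_omega C \<Phi>" "(y, z) \<in> Phi_fl_omega C \<Phi>"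
    then obtain r where "(x, y) \<in> Phi_fl C \<Phi> r" "(y, z) \<in> Phi_fl C \<Phi> r"
      by (rule Phi_fl_omega_common_stage[OF assms])
    then have "(x, z) \<in> Phi_fl C \<Phi> (Suc r)"
      by (auto simp: G_step_def)
    then show "(x, z) \<in> Phi_fl_omega C \<Phi>"
      using Phi_fl_subset_omega by blast
  qed
qed

lemma Phi_fl_omega_append:
  assumes "category C" "riguet_congruence C \<Phi>"
    and fs: "(fs, fs') \<in> Phi_fl_omega C \<Phi>" and gs: "(gs, gs') \<in> Phi_fl_omega C \<Phi>"
    and meet: "(tg C (last fs), sc C (hd gs)) \<in> fst \<Phi>"
  shows "(fs @ gs, fs' @ gs') \<in> Phi_fl_omega C \<Phi>"
proof -
  obtain r where r: "(fs, fs') \<in> Phi_fl C \<Phi> r" "(gs, gs') \<in> Phi_fl C \<Phi> r"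
    using Phi_fl_omega_common_stage[OF assms(1,2) fs gs] .
  (* Both concatenations are composable because concatenation stays inside the endpoint relation. *)
  have "(fs @ gs, fs' @ gs') \<in> endpoint_rel C (fst \<Phi>)"
    using generalized_congruenceD(7)[OF category.generalized_congruence_endpoint_rel[OF assms(1)
        riguet_congruence_equiv[OF assms(2)]], unfolded fst_conv snd_conv]
      Phi_fl_omega_subset_endpoint_rel[OF assms(1,2)] fs gs meet
    by (meson subsetD)
  then have "(fs @ gs, fs' @ gs') \<in> Phi_fl C \<Phi> (Suc r)"
    using r by (auto simp: G_step_def endpoint_rel_def)
  then show ?thesis
    using Phi_fl_subset_omega by blast
qed

lemma Union_fl_subset_omega: "Union_fl \<Phi> \<subseteq> Phi_fl_omega C \<Phi>"
  using Phi_fl_subset_omega[of C \<Phi> 0] by simp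

lemma generalized_congruence_Phi_fl_omega:
  assumes "category C" "riguet_congruence C \<Phi>"
  shows "generalized_congruence C (fst \<Phi>, Phi_fl_omega C \<Phi>)"
  unfolding generalized_congruence_def Let_def fst_conv snd_conv
proof (intro conjI)
  show "\<forall>(a, b) \<in> fst \<Phi>. ([idt C a], [idt C b]) \<in> Phi_fl_omega C \<Phi>"
    using Union_fl_idt[OF assms(2)] Union_fl_subset_omega by blast
  show "\<forall>(fs, gs) \<in> Phi_fl_omega C \<Phi>.
      (sc C (hd fs), sc C (hd gs)) \<in> fst \<Phi> \<and> (tg C (last fs), tg C (last gs)) \<in> fst \<Phi>"
    using Phi_fl_omega_subset_endpoint_rel[OF assms] by (auto simp: endpoint_rel_def)
  show "\<forall>f \<in> Mor C. \<forall>g \<in> Mor C. sc C g = tg C f \<longrightarrow> ([f, g], [cmp C g f]) \<in> Phi_fl_omega C \<Phi>"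
    using Phi_fl_subset_omega[of C \<Phi> 0] by (auto simp: comp_pairs_def)
  show "\<forall>(fs, fs') \<in> Phi_fl_omega C \<Phi>. \<forall>(gs, gs') \<in> Phi_fl_omega C \<Phi>.
      (tg C (last fs), sc C (hd gs)) \<in> fst \<Phi> \<longrightarrow> (fs @ gs, fs' @ gs') \<in> Phi_fl_omega C \<Phi>"
    using Phi_fl_omega_append[OF assms] by blast
qed (fact riguet_congruence_equiv[OF assms(2)] equiv_Phi_fl_omega[OF assms])+

section \<open>The generated congruence\<close>

theorem proposition2p41:
  fixes C :: "('o, 'm) cat" and \<Phi> :: "('o, 'm) riguet_pair"
  assumes "category C" and "riguet_congruence C \<Phi>"
  shows "snd (natural_congruence C \<Phi>) = Phi_fl_omega C \<Phi>"
proof -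
  let ?N = "natural_congruence C \<Phi>"
  have "fst \<Phi> \<subseteq> Ob C \<times> Ob C"
    using riguet_congruence_equiv[OF assms(2)] by (simp add: equiv_def)
  moreover have "Union_fl \<Phi> \<subseteq> Mor_plus C \<times> Mor_plus C"
    using Union_fl_subset_endpoint_rel[OF assms(2)] by (auto simp: endpoint_rel_def Mor_comp_def)
  ultimately have N: "generalized_congruence C ?N" "(fst \<Phi>, Union_fl \<Phi>) \<le> ?N"
    and least: "\<lbrakk>generalized_congruence C \<Psi>; (fst \<Phi>, Union_fl \<Phi>) \<le> \<Psi>\<rbrakk> \<Longrightarrow> ?N \<le> \<Psi>" for \<Psi>
    unfolding natural_congruence_def by (simp_all add: generated_congruence_least[OF assms(1)])
  have le: "?N \<le> (fst \<Phi>, Phi_fl_omega C \<Phi>)"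
    using generalized_congruence_Phi_fl_omega[OF assms] Union_fl_subset_omega[of \<Phi> C]
    by (intro least) (simp_all add: less_eq_prod_def)
  (* The stages concatenate over fst \<Phi>, so comparing them with the generated congruence
     needs that the latter identifies no further objects. *)
  then have "fst ?N = fst \<Phi>"
    using N(2) by (auto simp: less_eq_prod_def)
  then have "generalized_congruence C (fst \<Phi>, snd ?N)"
    using N(1) by (metis prod.collapse)
  then have "Phi_fl_omega C \<Phi> \<subseteq> snd ?N"
    using N(2) by (intro Phi_fl_omega_subset) (auto simp: less_eq_prod_def)
  then show ?thesis
    using le by (auto simp: less_eq_prod_def)
qed

end
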